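(* The sentence $$AC^{**} \equiv \forall x \exists y \forall z \exists a \forall b\, [(y \in x \wedge A(x,y,z,a)) \vee (y \notin x \wedge B(x,y,z,a,b))],$$ where $$A(x,y,z,a) \equiv z \in y \rightarrow (a \in x \wedge a \neq y \wedge z \in a)$$ and $$B(x,y,z,a,b) \equiv z \in x \rightarrow \big[(b \in z \rightarrow a \in z \wedge a \in y) \wedge (a \in z \wedge a \in y \rightarrow (b \in z \wedge b \in y \rightarrow b=a))\big],$$ is equivalent, in first-order predicate calculus with equality and without any axioms of set theory, to the sentence $$AC^* \equiv \forall x (AC_h^*(x) \rightarrow \exists y (y \notin x \wedge C(y,x))),$$ with $AC_h^*$ and $C$ as defined in the context.
   Context: The language is first-order predicate calculus with equality and one binary relation symbol $\in$ (models have non-empty domain). $C(y,x)$ ("$y$ is a choice-set for $x$") is $$\forall z \in x\, (\exists b\, b \in z \rightarrow \exists a (a \in z \wedge a \in y \wedge \forall b (b \in z \wedge b \in y \rightarrow b = a))).$$ $AC_h^*(x) \equiv \forall z \in x\, \exists a \in z\, \forall z' \in x\, (z \neq z' \rightarrow a \notin z')$, i.e. every element of $x$ contains an element not contained in any other element of $x$. *)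

theory Defs
  imports Main
begin

type_synonym var = string

datatype fm =
    Mem var var  (infix "\<^bold>\<in>" 80)
  | Eql var var  (infix "\<^bold>=" 80)
  | Fls          ("\<^bold>\<bottom>")
  | Con fm fm    (infixr "\<^bold>\<and>" 55)
  | Dis fm fm    (infixr "\<^bold>\<or>" 50)
  | Imp fm fm    (infixr "\<^bold>\<rightarrow>" 45)
  | All var fm   ("(3\<^bold>\<forall>_./ _)" [1000, 40] 40)
  | Exi var fm   ("(3\<^bold>\<exists>_./ _)" [1000, 40] 40)

abbreviation Neg :: "fm \<Rightarrow> fm"  ("\<^bold>\<not> _" [70] 70)
  where "\<^bold>\<not> p \<equiv> p \<^bold>\<rightarrow> \<^bold>\<bottom>"

abbreviation Iff :: "fm \<Rightarrow> fm \<Rightarrow> fm"  (infix "\<^bold>\<leftrightarrow>" 43)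
  where "p \<^bold>\<leftrightarrow> q \<equiv> (p \<^bold>\<rightarrow> q) \<^bold>\<and> (q \<^bold>\<rightarrow> p)"

abbreviation NotMem :: "var \<Rightarrow> var \<Rightarrow> fm"  (infix "\<^bold>\<notin>" 80)
  where "v \<^bold>\<notin> w \<equiv> \<^bold>\<not> (v \<^bold>\<in> w)"

abbreviation NotEql :: "var \<Rightarrow> var \<Rightarrow> fm"  (infix "\<^bold>\<noteq>" 80)
  where "v \<^bold>\<noteq> w \<equiv> \<^bold>\<not> (v \<^bold>= w)"

abbreviation BAll :: "var \<Rightarrow> var \<Rightarrow> fm \<Rightarrow> fm"  ("(3\<^bold>\<forall>_\<^bold>\<in>_./ _)" [1000, 1000, 40] 40)
  where "\<^bold>\<forall>v\<^bold>\<in>w. p \<equiv> \<^bold>\<forall>v. (v \<^bold>\<in> w \<^bold>\<rightarrow> p)"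

abbreviation BExi :: "var \<Rightarrow> var \<Rightarrow> fm \<Rightarrow> fm"  ("(3\<^bold>\<exists>_\<^bold>\<in>_./ _)" [1000, 1000, 40] 40)
  where "\<^bold>\<exists>v\<^bold>\<in>w. p \<equiv> \<^bold>\<exists>v. (v \<^bold>\<in> w \<^bold>\<and> p)"

primrec fv :: "fm \<Rightarrow> var set" where
  "fv (v \<^bold>\<in> w) = {v, w}"
| "fv (v \<^bold>= w) = {v, w}"
| "fv \<^bold>\<bottom> = {}"
| "fv (p \<^bold>\<and> q) = fv p \<union> fv q"
| "fv (p \<^bold>\<or> q) = fv p \<union> fv q"
| "fv (p \<^bold>\<rightarrow> q) = fv p \<union> fv q"
| "fv (\<^bold>\<forall>v. p) = fv p - {v}"
| "fv (\<^bold>\<exists>v. p) = fv p - {v}"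

text \<open>
  \<open>subst p v w\<close> replaces the free occurrences of \<open>v\<close> in \<open>p\<close> by \<open>w\<close> without renaming
  bound variables, so it is only meaningful when \<open>free_for w v p\<close> holds, i.e. when no such
  occurrence lies in the scope of a quantifier binding \<open>w\<close>.
\<close>

primrec subst :: "fm \<Rightarrow> var \<Rightarrow> var \<Rightarrow> fm" where
  "subst (s \<^bold>\<in> t) v w = ((if s = v then w else s) \<^bold>\<in> (if t = v then w else t))"
| "subst (s \<^bold>= t) v w = ((if s = v then w else s) \<^bold>= (if t = v then w else t))"
| "subst \<^bold>\<bottom> v w = \<^bold>\<bottom>"
| "subst (p \<^bold>\<and> q) v w = (subst p v w \<^bold>\<and> subst q v w)"
| "subst (p \<^bold>\<or> q) v w = (subst p v w \<^bold>\<or> subst q v w)"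
| "subst (p \<^bold>\<rightarrow> q) v w = (subst p v w \<^bold>\<rightarrow> subst q v w)"
| "subst (\<^bold>\<forall>u. p) v w = (\<^bold>\<forall>u. (if u = v then p else subst p v w))"
| "subst (\<^bold>\<exists>u. p) v w = (\<^bold>\<exists>u. (if u = v then p else subst p v w))"

primrec free_for :: "var \<Rightarrow> var \<Rightarrow> fm \<Rightarrow> bool" where
  "free_for w v (s \<^bold>\<in> t) = True"
| "free_for w v (s \<^bold>= t) = True"
| "free_for w v \<^bold>\<bottom> = True"
| "free_for w v (p \<^bold>\<and> q) = (free_for w v p \<and> free_for w v q)"
| "free_for w v (p \<^bold>\<or> q) = (free_for w v p \<and> free_for w v q)"
| "free_for w v (p \<^bold>\<rightarrow> q) = (free_for w v p \<and> free_for w v q)"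
| "free_for w v (\<^bold>\<forall>u. p) = (v \<notin> fv (\<^bold>\<forall>u. p) \<or> (u \<noteq> w \<and> free_for w v p))"
| "free_for w v (\<^bold>\<exists>u. p) = (v \<notin> fv (\<^bold>\<exists>u. p) \<or> (u \<noteq> w \<and> free_for w v p))"

text \<open>
  Classical natural deduction. There are no terms besides variables, and in \<open>AllI\<close> and \<open>ExiE\<close>
  the bound variable itself serves as the eigenvariable.
\<close>

inductive prv :: "fm set \<Rightarrow> fm \<Rightarrow> bool"  (infix "\<^bold>\<turnstile>" 38) where
  Assm:  "p \<in> G \<Longrightarrow> G \<^bold>\<turnstile> p"
| ConI:  "G \<^bold>\<turnstile> p \<Longrightarrow> G \<^bold>\<turnstile> q \<Longrightarrow> G \<^bold>\<turnstile> p \<^bold>\<and> q"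
| ConE1: "G \<^bold>\<turnstile> p \<^bold>\<and> q \<Longrightarrow> G \<^bold>\<turnstile> p"
| ConE2: "G \<^bold>\<turnstile> p \<^bold>\<and> q \<Longrightarrow> G \<^bold>\<turnstile> q"
| DisI1: "G \<^bold>\<turnstile> p \<Longrightarrow> G \<^bold>\<turnstile> p \<^bold>\<or> q"
| DisI2: "G \<^bold>\<turnstile> q \<Longrightarrow> G \<^bold>\<turnstile> p \<^bold>\<or> q"
| DisE:  "G \<^bold>\<turnstile> p \<^bold>\<or> q \<Longrightarrow> insert p G \<^bold>\<turnstile> r \<Longrightarrow> insert q G \<^bold>\<turnstile> r \<Longrightarrow> G \<^bold>\<turnstile> r"
| ImpI:  "insert p G \<^bold>\<turnstile> q \<Longrightarrow> G \<^bold>\<turnstile> p \<^bold>\<rightarrow> q"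
| ImpE:  "G \<^bold>\<turnstile> p \<^bold>\<rightarrow> q \<Longrightarrow> G \<^bold>\<turnstile> p \<Longrightarrow> G \<^bold>\<turnstile> q"
| Raa:   "insert (\<^bold>\<not> p) G \<^bold>\<turnstile> \<^bold>\<bottom> \<Longrightarrow> G \<^bold>\<turnstile> p"
| AllI:  "G \<^bold>\<turnstile> p \<Longrightarrow> \<forall>g\<in>G. v \<notin> fv g \<Longrightarrow> G \<^bold>\<turnstile> \<^bold>\<forall>v. p"
| AllE:  "G \<^bold>\<turnstile> \<^bold>\<forall>v. p \<Longrightarrow> free_for w v p \<Longrightarrow> G \<^bold>\<turnstile> subst p v w"
| ExiI:  "G \<^bold>\<turnstile> subst p v w \<Longrightarrow> free_for w v p \<Longrightarrow> G \<^bold>\<turnstile> \<^bold>\<exists>v. p"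
| ExiE:  "G \<^bold>\<turnstile> \<^bold>\<exists>v. p \<Longrightarrow> insert p G \<^bold>\<turnstile> q \<Longrightarrow> \<forall>g\<in>insert q G. v \<notin> fv g \<Longrightarrow> G \<^bold>\<turnstile> q"
| EqlI:  "G \<^bold>\<turnstile> v \<^bold>= v"
| EqlE:  "G \<^bold>\<turnstile> s \<^bold>= t \<Longrightarrow> G \<^bold>\<turnstile> subst p v s \<Longrightarrow> free_for s v p \<Longrightarrow> free_for t v p \<Longrightarrow>
            G \<^bold>\<turnstile> subst p v t"

primrec sat :: "'a set \<Rightarrow> ('a \<Rightarrow> 'a \<Rightarrow> bool) \<Rightarrow> (var \<Rightarrow> 'a) \<Rightarrow> fm \<Rightarrow> bool" where
  "sat D E e (v \<^bold>\<in> w) = E (e v) (e w)"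
| "sat D E e (v \<^bold>= w) = (e v = e w)"
| "sat D E e \<^bold>\<bottom> = False"
| "sat D E e (p \<^bold>\<and> q) = (sat D E e p \<and> sat D E e q)"
| "sat D E e (p \<^bold>\<or> q) = (sat D E e p \<or> sat D E e q)"
| "sat D E e (p \<^bold>\<rightarrow> q) = (sat D E e p \<longrightarrow> sat D E e q)"
| "sat D E e (\<^bold>\<forall>v. p) = (\<forall>d\<in>D. sat D E (e(v := d)) p)"
| "sat D E e (\<^bold>\<exists>v. p) = (\<exists>d\<in>D. sat D E (e(v := d)) p)"

text \<open>
  Structures have a non-empty domain \<open>D\<close>. This is required where \<open>true_in\<close> is used; for
  empty \<open>D\<close> there are no assignments and \<open>true_in D E p\<close> holds vacuously.
\<close>

definition true_in :: "'a set \<Rightarrow> ('a \<Rightarrow> 'a \<Rightarrow> bool) \<Rightarrow> fm \<Rightarrow> bool" where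
  "true_in D E p \<longleftrightarrow> (\<forall>e. range e \<subseteq> D \<longrightarrow> sat D E e p)"

lemma sat_cong: "(\<And>v. v \<in> fv p \<Longrightarrow> e v = e' v) \<Longrightarrow> sat D E e p = sat D E e' p"
proof (induction p arbitrary: e e')
  case (All v p)
  have "sat D E (e(v := d)) p = sat D E (e'(v := d)) p" for d
    by (rule All.IH) (use All.prems in auto)
  then show ?case by simp
next
  case (Exi v p)
  have "sat D E (e(v := d)) p = sat D E (e'(v := d)) p" for d
    by (rule Exi.IH) (use Exi.prems in auto)
  then show ?case by simp
next
  case (Con p q)
  then show ?case by (metis UnCI fv.simps(4) sat.simps(4))
next
  case (Dis p q)
  then show ?case by (metis UnCI fv.simps(5) sat.simps(5))
next
  case (Imp p q)
  then show ?case by (metis UnCI fv.simps(6) sat.simps(6))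
qed auto

lemma subst_idle: "v \<notin> fv p \<Longrightarrow> subst p v w = p"
  by (induction p) auto

lemma sat_subst: "free_for w v p \<Longrightarrow> sat D E e (subst p v w) = sat D E (e(v := e w)) p"
proof (induction p arbitrary: e)
  case (All u p)
  show ?case
  proof (cases "v \<in> fv (\<^bold>\<forall>u. p)")
    case True
    with All.prems have "free_for w v p" "u \<noteq> w" "u \<noteq> v" by auto
    then have "sat D E (e(u := d)) (subst p v w) = sat D E (e(v := e w, u := d)) p" for d
      using All.IH[of "e(u := d)"] by (metis fun_upd_other fun_upd_twist)
    with \<open>u \<noteq> v\<close> show ?thesis by (simp add: fun_upd_def)
  next
    case False
    then have "subst (\<^bold>\<forall>u. p) v w = (\<^bold>\<forall>u. p)" by (rule subst_idle)
    moreover have "sat D E e (\<^bold>\<forall>u. p) = sat D E (e(v := e w)) (\<^bold>\<forall>u. p)"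
      by (rule sat_cong) (use False in auto)
    ultimately show ?thesis by (simp only:)
  qed
next
  case (Exi u p)
  show ?case
  proof (cases "v \<in> fv (\<^bold>\<exists>u. p)")
    case True
    with Exi.prems have "free_for w v p" "u \<noteq> w" "u \<noteq> v" by auto
    then have "sat D E (e(u := d)) (subst p v w) = sat D E (e(v := e w, u := d)) p" for d
      using Exi.IH[of "e(u := d)"] by (metis fun_upd_other fun_upd_twist)
    with \<open>u \<noteq> v\<close> show ?thesis by (simp add: fun_upd_def)
  next
    case False
    then have "subst (\<^bold>\<exists>u. p) v w = (\<^bold>\<exists>u. p)" by (rule subst_idle)
    moreover have "sat D E e (\<^bold>\<exists>u. p) = sat D E (e(v := e w)) (\<^bold>\<exists>u. p)"
      by (rule sat_cong) (use False in auto)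
    ultimately show ?thesis by (simp only:)
  qed
qed auto

theorem soundness:
  assumes "G \<^bold>\<turnstile> p" and "range e \<subseteq> D" and "\<forall>g\<in>G. sat D E e g"
  shows "sat D E e p"
  using assms
proof (induction arbitrary: e rule: prv.induct)
  case (AllI G p v)
  have "sat D E (e(v := d)) p" if "d \<in> D" for d
  proof (rule AllI.IH)
    show "range (e(v := d)) \<subseteq> D" using that AllI.prems by auto
    show "\<forall>g\<in>G. sat D E (e(v := d)) g"
      using AllI.prems AllI.hyps sat_cong[of _ "e(v := d)" e] by fastforce
  qed
  then show ?case by simp
next
  case (AllE G v p w)
  then have "e w \<in> D" by auto
  with AllE show ?case by (auto simp: sat_subst)
next
  case (ExiI G p v w)
  then have "e w \<in> D" by auto
  with ExiI show ?case by (auto simp: sat_subst)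
next
  case (ExiE G v p q)
  from ExiE.IH(1)[OF ExiE.prems] obtain d where d: "d \<in> D" "sat D E (e(v := d)) p" by auto
  have "sat D E (e(v := d)) q"
  proof (rule ExiE.IH(2))
    show "range (e(v := d)) \<subseteq> D" using d ExiE.prems by auto
    show "\<forall>g\<in>insert p G. sat D E (e(v := d)) g"
      using d ExiE.prems ExiE.hyps sat_cong[of _ "e(v := d)" e] by fastforce
  qed
  then show ?case using ExiE.hyps sat_cong[of q "e(v := d)" e] by fastforce
next
  case (EqlE G s t p v)
  from EqlE.IH(1)[OF EqlE.prems] have "e s = e t" by simp
  moreover from EqlE.IH(2)[OF EqlE.prems] EqlE.hyps have "sat D E (e(v := e s)) p"
    by (simp add: sat_subst)
  ultimately show ?case using EqlE.hyps by (simp add: sat_subst)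
next
  case (Raa p G)
  then show ?case by (metis insert_iff sat.simps(3) sat.simps(6))
qed auto

text \<open>
  The formulas with parameters are open formulas in fixed variables: \<open>AC_h\<close> has the free
  variable \<open>x\<close>, \<open>Choice\<close> has \<open>y, x\<close>, \<open>A_fm\<close> has \<open>x, y, z, a\<close> and \<open>B_fm\<close> has \<open>x, y, z, a, b\<close>.
  The variable called \<open>z'\<close> on paper is \<open>z1\<close> here.
\<close>

definition Choice :: fm where
  "Choice =
    (\<^bold>\<forall>''z''\<^bold>\<in>''x''. (\<^bold>\<exists>''b''. ''b'' \<^bold>\<in> ''z'') \<^bold>\<rightarrow>
       (\<^bold>\<exists>''a''. ''a'' \<^bold>\<in> ''z'' \<^bold>\<and> ''a'' \<^bold>\<in> ''y'' \<^bold>\<and>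
          (\<^bold>\<forall>''b''. ''b'' \<^bold>\<in> ''z'' \<^bold>\<and> ''b'' \<^bold>\<in> ''y'' \<^bold>\<rightarrow> ''b'' \<^bold>= ''a'')))"

definition AC_h :: fm where
  "AC_h =
    (\<^bold>\<forall>''z''\<^bold>\<in>''x''. \<^bold>\<exists>''a''\<^bold>\<in>''z''. \<^bold>\<forall>''z1''\<^bold>\<in>''x''. ''z'' \<^bold>\<noteq> ''z1'' \<^bold>\<rightarrow> ''a'' \<^bold>\<notin> ''z1'')"

definition AC_star :: fm where
  "AC_star = (\<^bold>\<forall>''x''. AC_h \<^bold>\<rightarrow> (\<^bold>\<exists>''y''. ''y'' \<^bold>\<notin> ''x'' \<^bold>\<and> Choice))"

definition A_fm :: fm where
  "A_fm = (''z'' \<^bold>\<in> ''y'' \<^bold>\<rightarrow> (''a'' \<^bold>\<in> ''x'' \<^bold>\<and> ''a'' \<^bold>\<noteq> ''y'' \<^bold>\<and> ''z'' \<^bold>\<in> ''a''))"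

definition B_fm :: fm where
  "B_fm =
    (''z'' \<^bold>\<in> ''x'' \<^bold>\<rightarrow>
       ((''b'' \<^bold>\<in> ''z'' \<^bold>\<rightarrow> ''a'' \<^bold>\<in> ''z'' \<^bold>\<and> ''a'' \<^bold>\<in> ''y'') \<^bold>\<and>
        (''a'' \<^bold>\<in> ''z'' \<^bold>\<and> ''a'' \<^bold>\<in> ''y'' \<^bold>\<rightarrow>
          (''b'' \<^bold>\<in> ''z'' \<^bold>\<and> ''b'' \<^bold>\<in> ''y'' \<^bold>\<rightarrow> ''b'' \<^bold>= ''a''))))"

definition AC_star_star :: fm where
  "AC_star_star =
    (\<^bold>\<forall>''x''. \<^bold>\<exists>''y''. \<^bold>\<forall>''z''. \<^bold>\<exists>''a''. \<^bold>\<forall>''b''.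
       (''y'' \<^bold>\<in> ''x'' \<^bold>\<and> A_fm) \<^bold>\<or> (''y'' \<^bold>\<notin> ''x'' \<^bold>\<and> B_fm))"

lemma fv_AC_star: "fv AC_star = {}"
  by (auto simp: AC_star_def AC_h_def Choice_def)

lemma fv_AC_star_star: "fv AC_star_star = {}"
  by (auto simp: AC_star_star_def A_fm_def B_fm_def)

end

theory Submission
  imports Defs
begin

text \<open>
  Pulling the quantifiers inwards, the disjunct \<open>y \<in> x \<and> A\<close> says that \<open>y\<close> is an element of \<open>x\<close>
  all of whose members lie in other elements of \<open>x\<close>, so that it witnesses the failure of
  \<open>AC_h\<close> at \<open>x\<close>. The disjunct \<open>y \<notin> x \<and> B\<close> says that \<open>y\<close> is a choice-set for \<open>x\<close> outside \<open>x\<close>;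
  an empty \<open>z\<close> imposes no condition, since then any \<open>a\<close> will do.

  The calculus has no weakening rule, and weakening is not immediate because of the eigenvariable
  conditions. So each derivation keeps one growing set of assumptions, to which intermediate
  results are added by cuts.
\<close>

section \<open>Derived rules of the calculus\<close>

lemma subst_self: "subst p v v = p"
  by (induction p) auto

lemma free_for_self: "free_for v v p"
  by (induction p) auto

text \<open>Eigenvariables are the bound variables themselves, so most instantiations below keep the
  name of the variable, and the \<open>free_for\<close> condition is then automatic.\<close>

lemma AllE_self: "G \<^bold>\<turnstile> \<^bold>\<forall>v. p \<Longrightarrow> G \<^bold>\<turnstile> p"
  using AllE[OF _ free_for_self] by (simp add: subst_self)

lemma ExiI_self: "G \<^bold>\<turnstile> p \<Longrightarrow> G \<^bold>\<turnstile> \<^bold>\<exists>v. p"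
  by (rule ExiI[where w = v]) (simp_all add: subst_self free_for_self)

text \<open>For genuine renamings: the computed instance \<open>q\<close> need not match the
  unevaluated \<open>subst p v w\<close>; the equation between them is left to
  simplification.\<close>

lemma AllE_eq: "G \<^bold>\<turnstile> \<^bold>\<forall>v. p \<Longrightarrow> free_for w v p \<Longrightarrow> subst p v w = q \<Longrightarrow> G \<^bold>\<turnstile> q"
  using AllE by blast

lemma ExiI_eq: "G \<^bold>\<turnstile> q \<Longrightarrow> free_for w v p \<Longrightarrow> subst p v w = q \<Longrightarrow> G \<^bold>\<turnstile> \<^bold>\<exists>v. p"
  using ExiI by blast

lemma cut: "G \<^bold>\<turnstile> p \<Longrightarrow> insert p G \<^bold>\<turnstile> q \<Longrightarrow> G \<^bold>\<turnstile> q"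
  by (rule ImpE[OF ImpI])

lemma contradiction:
  assumes "G \<^bold>\<turnstile> p" and "G \<^bold>\<turnstile> \<^bold>\<not> p"
  shows "G \<^bold>\<turnstile> q"
proof -
  have "G \<^bold>\<turnstile> \<^bold>\<bottom> \<^bold>\<rightarrow> q"
    by (rule ImpI, rule Raa, rule Assm) simp
  from ImpE[OF this ImpE[OF assms(2,1)]] show ?thesis .
qed

lemma excluded_middle: "G \<^bold>\<turnstile> p \<^bold>\<or> \<^bold>\<not> p"
proof (rule Raa)
  let ?G = "insert (\<^bold>\<not> (p \<^bold>\<or> \<^bold>\<not> p)) G"
  have "?G \<^bold>\<turnstile> \<^bold>\<not> p"
    by (rule ImpI, rule ImpE[OF Assm DisI1[OF Assm]]) auto
  from ImpE[OF Assm[of "\<^bold>\<not> (p \<^bold>\<or> \<^bold>\<not> p)"] DisI2[OF this]] show "?G \<^bold>\<turnstile> \<^bold>\<bottom>"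
    by simp
qed

lemma case_split: "insert p G \<^bold>\<turnstile> q \<Longrightarrow> insert (\<^bold>\<not> p) G \<^bold>\<turnstile> q \<Longrightarrow> G \<^bold>\<turnstile> q"
  by (rule DisE[OF excluded_middle])

lemma Eql_sym:
  assumes "G \<^bold>\<turnstile> s \<^bold>= t"
  shows "G \<^bold>\<turnstile> t \<^bold>= s"
proof -
  \<comment> \<open>Leibniz's law is applied to \<open>v = s\<close>. Since \<open>v\<close> differs
    from \<open>s\<close>, only the left side is replaced: \<open>s = s\<close> becomes
    \<open>t = s\<close>.\<close>
  obtain v :: var where "v \<noteq> s"
    using not_Cons_self by blast
  then show ?thesis
    using EqlE[OF assms, of "v \<^bold>= s" v] EqlI[of G s] by simp
qed

text \<open>Needed because \<open>AC_h\<close> compares the fixed set with the other one, while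
  \<open>A_fm\<close> states the inequality the other way round.\<close>

lemma NotEql_sym:
  assumes "G \<^bold>\<turnstile> s \<^bold>\<noteq> t"
  shows "G \<^bold>\<turnstile> t \<^bold>\<noteq> s"
proof -
  have "G \<^bold>\<turnstile> s \<^bold>\<noteq> t \<^bold>\<rightarrow> t \<^bold>\<noteq> s"
    by (intro ImpI, rule ImpE[OF Assm Eql_sym[OF Assm]]) auto
  from ImpE[OF this assms] show ?thesis .
qed

text \<open>The matrix of \<open>AC_star_star\<close> has this shape with \<open>p\<close> being
  \<open>y \<in> x\<close>: deciding \<open>p\<close> selects the branch \<open>A_fm\<close> or
  \<open>B_fm\<close>.\<close>

lemma guarded_Dis_pos:
  assumes "G \<^bold>\<turnstile> p \<^bold>\<and> q \<^bold>\<or> \<^bold>\<not> p \<^bold>\<and> r" and "G \<^bold>\<turnstile> p"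
  shows "G \<^bold>\<turnstile> q"
proof -
  let ?H = "insert p (insert (p \<^bold>\<and> q \<^bold>\<or> \<^bold>\<not> p \<^bold>\<and> r) G)"
  have "?H \<^bold>\<turnstile> q"
  proof (rule DisE)
    show "?H \<^bold>\<turnstile> p \<^bold>\<and> q \<^bold>\<or> \<^bold>\<not> p \<^bold>\<and> r"
      by (rule Assm) simp
    show "insert (p \<^bold>\<and> q) ?H \<^bold>\<turnstile> q"
      by (rule ConE2[OF Assm[of "p \<^bold>\<and> q"]]) simp
    show "insert (\<^bold>\<not> p \<^bold>\<and> r) ?H \<^bold>\<turnstile> q"
      by (rule contradiction[OF Assm ConE1[OF Assm[of "\<^bold>\<not> p \<^bold>\<and> r"]]]) auto
  qed
  from ImpE[OF ImpE[OF ImpI[OF ImpI[OF this]] assms(1)] assms(2)] show ?thesis .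
qed

lemma guarded_Dis_neg:
  assumes "G \<^bold>\<turnstile> p \<^bold>\<and> q \<^bold>\<or> \<^bold>\<not> p \<^bold>\<and> r" and "G \<^bold>\<turnstile> \<^bold>\<not> p"
  shows "G \<^bold>\<turnstile> r"
proof -
  let ?H = "insert (\<^bold>\<not> p) (insert (p \<^bold>\<and> q \<^bold>\<or> \<^bold>\<not> p \<^bold>\<and> r) G)"
  have "?H \<^bold>\<turnstile> r"
  proof (rule DisE)
    show "?H \<^bold>\<turnstile> p \<^bold>\<and> q \<^bold>\<or> \<^bold>\<not> p \<^bold>\<and> r"
      by (rule Assm) simp
    show "insert (p \<^bold>\<and> q) ?H \<^bold>\<turnstile> r"
      by (rule contradiction[OF ConE1[OF Assm[of "p \<^bold>\<and> q"]] Assm]) auto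
    show "insert (\<^bold>\<not> p \<^bold>\<and> r) ?H \<^bold>\<turnstile> r"
      by (rule ConE2[OF Assm[of "\<^bold>\<not> p \<^bold>\<and> r"]]) simp
  qed
  from ImpE[OF ImpE[OF ImpI[OF ImpI[OF this]] assms(1)] assms(2)] show ?thesis .
qed

section \<open>From \<open>AC_star_star\<close> to \<open>AC_star\<close>\<close>

text \<open>The \<open>y\<close> that \<open>AC_star_star\<close> supplies for \<open>x\<close> is
  itself the required choice-set: \<open>AC_h\<close> rules out the branch
  \<open>y \<in> x\<close>.\<close>

lemma AC_star_star_imp_AC_star: "{AC_star_star} \<^bold>\<turnstile> AC_star"
proof -
  let ?M = "(''y'' \<^bold>\<in> ''x'' \<^bold>\<and> A_fm) \<^bold>\<or> (''y'' \<^bold>\<notin> ''x'' \<^bold>\<and> B_fm)"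
  let ?Phi = "\<^bold>\<forall>''z''. \<^bold>\<exists>''a''. \<^bold>\<forall>''b''. ?M"
  let ?G = "{?Phi, AC_h, AC_star_star}"
  let ?R = "''z'' \<^bold>\<in> ''y'' \<^bold>\<and> (\<^bold>\<forall>''z1''\<^bold>\<in>''x''. ''y'' \<^bold>\<noteq> ''z1'' \<^bold>\<rightarrow> ''z'' \<^bold>\<notin> ''z1'')"
  let ?Ra = "''a'' \<^bold>\<in> ''y'' \<^bold>\<and> (\<^bold>\<forall>''z1''\<^bold>\<in>''x''. ''y'' \<^bold>\<noteq> ''z1'' \<^bold>\<rightarrow> ''a'' \<^bold>\<notin> ''z1'')"
  have y: "?G \<^bold>\<turnstile> ''y'' \<^bold>\<notin> ''x''"
  proof (rule ImpI)
    let ?H = "insert (''y'' \<^bold>\<in> ''x'') ?G"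
    have "?H \<^bold>\<turnstile> AC_h"
      by (rule Assm) simp
    then have "?H \<^bold>\<turnstile> ''y'' \<^bold>\<in> ''x'' \<^bold>\<rightarrow> (\<^bold>\<exists>''a''. ?Ra)"
      unfolding AC_h_def by (rule AllE_eq[where w = "''y''"]) simp_all
    then have Ra: "?H \<^bold>\<turnstile> \<^bold>\<exists>''a''. ?Ra"
      by (rule ImpE) (simp add: Assm)
    \<comment> \<open>\<open>?Phi\<close> cannot be instantiated to \<open>a\<close>, which it binds, so the witness is called \<open>z\<close>.\<close>
    have "?H \<^bold>\<turnstile> \<^bold>\<exists>''z''. ?R"
    proof (rule ExiE[OF Ra])
      show "insert ?Ra ?H \<^bold>\<turnstile> \<^bold>\<exists>''z''. ?R"
        by (rule ExiI_eq[where w = "''a''" and q = ?Ra]) (simp_all add: Assm)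
    qed (auto simp: fv_AC_star_star AC_h_def)
    then show "?H \<^bold>\<turnstile> \<^bold>\<bottom>"
    proof (rule ExiE)
      let ?H1 = "insert ?R ?H"
      have "?H1 \<^bold>\<turnstile> ?Phi"
        by (rule Assm) simp
      then have "?H1 \<^bold>\<turnstile> \<^bold>\<exists>''a''. \<^bold>\<forall>''b''. ?M"
        by (rule AllE_self)
      then show "?H1 \<^bold>\<turnstile> \<^bold>\<bottom>"
      proof (rule ExiE)
        let ?H2 = "insert (\<^bold>\<forall>''b''. ?M) ?H1"
        have "?H2 \<^bold>\<turnstile> ?M"
          by (rule AllE_self[OF Assm[of "\<^bold>\<forall>''b''. ?M"]]) simp
        then have A: "?H2 \<^bold>\<turnstile> A_fm"
          by (rule guarded_Dis_pos) (simp add: Assm)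
        have R: "?H2 \<^bold>\<turnstile> ?R"
          by (rule Assm) simp
        have a: "?H2 \<^bold>\<turnstile> ''a'' \<^bold>\<in> ''x'' \<^bold>\<and> ''a'' \<^bold>\<noteq> ''y'' \<^bold>\<and> ''z'' \<^bold>\<in> ''a''"
          using A ConE1[OF R] unfolding A_fm_def by (rule ImpE)
        \<comment> \<open>The set \<open>a\<close> supplied by \<open>A_fm\<close> is an element of
          \<open>x\<close> other than \<open>y\<close> containing \<open>z\<close>, but
          \<open>z\<close> was chosen to lie in no such set.\<close>
        have "?H2 \<^bold>\<turnstile> ''a'' \<^bold>\<in> ''x'' \<^bold>\<rightarrow> ''y'' \<^bold>\<noteq> ''a'' \<^bold>\<rightarrow> ''z'' \<^bold>\<notin> ''a''"
          by (rule AllE_eq[OF ConE2[OF R], where w = "''a''"]) simp_all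
        from ImpE[OF ImpE[OF this ConE1[OF a]] NotEql_sym[OF ConE1[OF ConE2[OF a]]]]
        show "?H2 \<^bold>\<turnstile> \<^bold>\<bottom>"
          using ConE2[OF ConE2[OF a]] by (rule ImpE)
      qed (auto simp: fv_AC_star_star AC_h_def)
    qed (auto simp: fv_AC_star_star AC_h_def)
  qed
  \<comment> \<open>\<open>y \<notin> x\<close> is kept as an assumption so that it is available in
    all larger contexts of this derivation; a cut with the fact \<open>y\<close> removes it
    later.\<close>
  have C: "insert (''y'' \<^bold>\<notin> ''x'') ?G \<^bold>\<turnstile> Choice"
    unfolding Choice_def
  proof (intro AllI ImpI)
    let ?H = "insert (\<^bold>\<exists>''b''. ''b'' \<^bold>\<in> ''z'') (insert (''z'' \<^bold>\<in> ''x'') (insert (''y'' \<^bold>\<notin> ''x'') ?G))"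
    let ?U = "\<^bold>\<forall>''b''. ''b'' \<^bold>\<in> ''z'' \<^bold>\<and> ''b'' \<^bold>\<in> ''y'' \<^bold>\<rightarrow> ''b'' \<^bold>= ''a''"
    let ?a = "''a'' \<^bold>\<in> ''z'' \<^bold>\<and> ''a'' \<^bold>\<in> ''y''"
    have "?H \<^bold>\<turnstile> ?Phi"
      by (rule Assm) simp
    then have "?H \<^bold>\<turnstile> \<^bold>\<exists>''a''. \<^bold>\<forall>''b''. ?M"
      by (rule AllE_self)
    then show "?H \<^bold>\<turnstile> \<^bold>\<exists>''a''. ''a'' \<^bold>\<in> ''z'' \<^bold>\<and> ''a'' \<^bold>\<in> ''y'' \<^bold>\<and> ?U"
    proof (rule ExiE)
      let ?H1 = "insert (\<^bold>\<forall>''b''. ?M) ?H"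
      \<comment> \<open>Quantifying over all contexts \<open>K\<close> above \<open>?H1\<close>
        takes the place of weakening.\<close>
      have B: "K \<^bold>\<turnstile> (''b'' \<^bold>\<in> ''z'' \<^bold>\<rightarrow> ?a) \<^bold>\<and>
          (?a \<^bold>\<rightarrow> ''b'' \<^bold>\<in> ''z'' \<^bold>\<and> ''b'' \<^bold>\<in> ''y'' \<^bold>\<rightarrow> ''b'' \<^bold>= ''a'')" if "?H1 \<subseteq> K" for K
      proof -
        have "K \<^bold>\<turnstile> ?M"
          by (rule AllE_self[OF Assm[of "\<^bold>\<forall>''b''. ?M"]]) (use that in simp)
        then have "K \<^bold>\<turnstile> B_fm"
          by (rule guarded_Dis_neg) (use that in \<open>simp add: Assm\<close>)
        then show ?thesis
          unfolding B_fm_def by (rule ImpE) (use that in \<open>simp add: Assm\<close>)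
      qed
      have "?H1 \<^bold>\<turnstile> \<^bold>\<exists>''b''. ''b'' \<^bold>\<in> ''z''"
        by (rule Assm) simp
      \<comment> \<open>Any \<open>b\<close> in \<open>z\<close> triggers the first clause of
        \<open>B_fm\<close>. Its conclusion does not mention \<open>b\<close>, so \<open>b\<close>
        can be eliminated.\<close>
      then have a: "?H1 \<^bold>\<turnstile> ?a"
      proof (rule ExiE)
        let ?H2 = "insert (''b'' \<^bold>\<in> ''z'') ?H1"
        show "?H2 \<^bold>\<turnstile> ?a"
          by (rule ImpE[OF ConE1[OF B] Assm]) auto
      qed (auto simp: fv_AC_star_star AC_h_def)
      have "?H1 \<^bold>\<turnstile> ?U"
      proof (rule cut[OF a], intro AllI ImpI)
        let ?H2 = "insert (''b'' \<^bold>\<in> ''z'' \<^bold>\<and> ''b'' \<^bold>\<in> ''y'') (insert ?a ?H1)"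
        show "?H2 \<^bold>\<turnstile> ''b'' \<^bold>= ''a''"
          by (rule ImpE[OF ImpE[OF ConE2[OF B] Assm] Assm]) auto
      qed (auto simp: fv_AC_star_star AC_h_def)
      then show "?H1 \<^bold>\<turnstile> \<^bold>\<exists>''a''. ''a'' \<^bold>\<in> ''z'' \<^bold>\<and> ''a'' \<^bold>\<in> ''y'' \<^bold>\<and> ?U"
        by (intro ExiI_self ConI ConE1[OF a] ConE2[OF a])
    qed (auto simp: fv_AC_star_star AC_h_def)
  qed (auto simp: fv_AC_star_star AC_h_def)
  show ?thesis
    unfolding AC_star_def
  proof (intro AllI ImpI)
    have "{AC_h, AC_star_star} \<^bold>\<turnstile> AC_star_star"
      by (rule Assm) simp
    then have "{AC_h, AC_star_star} \<^bold>\<turnstile> \<^bold>\<exists>''y''. ?Phi"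
      unfolding AC_star_star_def by (rule AllE_self)
    then show "{AC_h, AC_star_star} \<^bold>\<turnstile> \<^bold>\<exists>''y''. ''y'' \<^bold>\<notin> ''x'' \<^bold>\<and> Choice"
    proof (rule ExiE)
      show "?G \<^bold>\<turnstile> \<^bold>\<exists>''y''. ''y'' \<^bold>\<notin> ''x'' \<^bold>\<and> Choice"
        by (intro ExiI_self ConI y cut[OF y C])
    qed (auto simp: fv_AC_star_star AC_h_def)
  qed (auto simp: fv_AC_star_star)
qed

section \<open>From \<open>AC_star\<close> to \<open>AC_star_star\<close>\<close>

text \<open>Case distinction on \<open>AC_h\<close> at \<open>x\<close>: if it holds,
  \<open>y\<close> is the choice-set given by \<open>AC_star\<close>; otherwise \<open>y\<close> is
  an element of \<open>x\<close> at which \<open>AC_h\<close> fails.\<close>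

lemma AC_star_imp_AC_star_star: "{AC_star} \<^bold>\<turnstile> AC_star_star"
proof -
  let ?M = "(''y'' \<^bold>\<in> ''x'' \<^bold>\<and> A_fm) \<^bold>\<or> (''y'' \<^bold>\<notin> ''x'' \<^bold>\<and> B_fm)"
  let ?goal = "\<^bold>\<exists>''y''. \<^bold>\<forall>''z''. \<^bold>\<exists>''a''. \<^bold>\<forall>''b''. ?M"
  have choice_case: "{AC_h, AC_star} \<^bold>\<turnstile> ?goal"
  proof -
    let ?G = "{AC_h, AC_star}"
    let ?Y = "''y'' \<^bold>\<notin> ''x'' \<^bold>\<and> Choice"
    have "?G \<^bold>\<turnstile> AC_star"
      by (rule Assm) simp
    then have "?G \<^bold>\<turnstile> AC_h \<^bold>\<rightarrow> (\<^bold>\<exists>''y''. ?Y)"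
      unfolding AC_star_def by (rule AllE_self)
    then have "?G \<^bold>\<turnstile> \<^bold>\<exists>''y''. ?Y"
      by (rule ImpE) (simp add: Assm)
    then show ?thesis
    proof (rule ExiE)
      let ?H = "insert ?Y ?G"
      \<comment> \<open>\<open>?P\<close> is the condition under which \<open>Choice\<close>
        provides an \<open>a\<close> for \<open>z\<close>; the existence of \<open>a\<close> is
        proved by cases on it.\<close>
      let ?P = "''z'' \<^bold>\<in> ''x'' \<^bold>\<and> (\<^bold>\<exists>''b''. ''b'' \<^bold>\<in> ''z'')"
      let ?U = "\<^bold>\<forall>''b''. ''b'' \<^bold>\<in> ''z'' \<^bold>\<and> ''b'' \<^bold>\<in> ''y'' \<^bold>\<rightarrow> ''b'' \<^bold>= ''a''"
      let ?Q = "''a'' \<^bold>\<in> ''z'' \<^bold>\<and> ''a'' \<^bold>\<in> ''y'' \<^bold>\<and> ?U"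
      have nonempty: "insert ?P ?H \<^bold>\<turnstile> \<^bold>\<exists>''a''. \<^bold>\<forall>''b''. ?M"
      proof -
        let ?K = "insert ?P ?H"
        have P: "?K \<^bold>\<turnstile> ?P"
          by (rule Assm) simp
        have "?K \<^bold>\<turnstile> Choice"
          by (rule ConE2[OF Assm[of ?Y]]) simp
        then have "?K \<^bold>\<turnstile> ''z'' \<^bold>\<in> ''x'' \<^bold>\<rightarrow> (\<^bold>\<exists>''b''. ''b'' \<^bold>\<in> ''z'') \<^bold>\<rightarrow> (\<^bold>\<exists>''a''. ?Q)"
          unfolding Choice_def by (rule AllE_self)
        from ImpE[OF ImpE[OF this ConE1[OF P]] ConE2[OF P]] show ?thesis
        proof (rule ExiE)
          let ?L = "insert ?Q ?K"
          have Q: "K \<^bold>\<turnstile> ?Q" if "?L \<subseteq> K" for K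
            by (rule Assm) (use that in simp)
          have U: "K \<^bold>\<turnstile> ''b'' \<^bold>\<in> ''z'' \<^bold>\<and> ''b'' \<^bold>\<in> ''y'' \<^bold>\<rightarrow> ''b'' \<^bold>= ''a''" if "?L \<subseteq> K" for K
            by (rule AllE_self[OF ConE2[OF ConE2[OF Q[OF that]]]])
          have "?L \<^bold>\<turnstile> B_fm"
            unfolding B_fm_def
          proof (intro ImpI ConI)
            show "insert (''b'' \<^bold>\<in> ''z'') (insert (''z'' \<^bold>\<in> ''x'') ?L) \<^bold>\<turnstile> ''a'' \<^bold>\<in> ''z''"
              by (rule ConE1[OF Q]) auto
            show "insert (''b'' \<^bold>\<in> ''z'') (insert (''z'' \<^bold>\<in> ''x'') ?L) \<^bold>\<turnstile> ''a'' \<^bold>\<in> ''y''"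
              by (rule ConE1[OF ConE2[OF Q]]) auto
            show "insert (''b'' \<^bold>\<in> ''z'' \<^bold>\<and> ''b'' \<^bold>\<in> ''y'') (insert (''a'' \<^bold>\<in> ''z'' \<^bold>\<and> ''a'' \<^bold>\<in> ''y'')
                (insert (''z'' \<^bold>\<in> ''x'') ?L)) \<^bold>\<turnstile> ''b'' \<^bold>= ''a''"
              by (rule ImpE[OF U Assm]) auto
          qed
          moreover have "?L \<^bold>\<turnstile> ''y'' \<^bold>\<notin> ''x''"
            by (rule ConE1[OF Assm[of ?Y]]) simp
          ultimately have "?L \<^bold>\<turnstile> ?M"
            by (intro DisI2 ConI)
          then show "?L \<^bold>\<turnstile> \<^bold>\<exists>''a''. \<^bold>\<forall>''b''. ?M"
            by (intro ExiI_self AllI) (auto simp: fv_AC_star AC_h_def Choice_def)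
        qed (auto simp: fv_AC_star AC_h_def Choice_def)
      qed
      \<comment> \<open>Each clause of \<open>B_fm\<close> assumes both \<open>z \<in> x\<close> and
        \<open>b \<in> z\<close>, which contradicts the failure of \<open>?P\<close>. So
        \<open>B_fm\<close> holds vacuously and an arbitrary \<open>a\<close> serves.\<close>
      have empty: "insert (\<^bold>\<not> ?P) ?H \<^bold>\<turnstile> \<^bold>\<exists>''a''. \<^bold>\<forall>''b''. ?M"
      proof -
        let ?K = "insert (\<^bold>\<not> ?P) ?H"
        have absurd: "L \<^bold>\<turnstile> q"
          if "insert (''z'' \<^bold>\<in> ''x'') ?K \<subseteq> L" and b: "L \<^bold>\<turnstile> ''b'' \<^bold>\<in> ''z''" for L q
        proof (rule contradiction)
          show "L \<^bold>\<turnstile> ?P"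
            by (rule ConI[OF Assm ExiI_self[OF b]]) (use that(1) in simp)
          show "L \<^bold>\<turnstile> \<^bold>\<not> ?P"
            by (rule Assm) (use that(1) in simp)
        qed
        have "?K \<^bold>\<turnstile> B_fm"
          unfolding B_fm_def
        proof (rule ImpI, rule ConI)
          show "insert (''z'' \<^bold>\<in> ''x'') ?K \<^bold>\<turnstile> ''b'' \<^bold>\<in> ''z'' \<^bold>\<rightarrow> ''a'' \<^bold>\<in> ''z'' \<^bold>\<and> ''a'' \<^bold>\<in> ''y''"
            by (rule ImpI, rule absurd[OF _ Assm]) auto
          show "insert (''z'' \<^bold>\<in> ''x'') ?K \<^bold>\<turnstile> ''a'' \<^bold>\<in> ''z'' \<^bold>\<and> ''a'' \<^bold>\<in> ''y'' \<^bold>\<rightarrow>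
              ''b'' \<^bold>\<in> ''z'' \<^bold>\<and> ''b'' \<^bold>\<in> ''y'' \<^bold>\<rightarrow> ''b'' \<^bold>= ''a''"
            by (intro ImpI, rule absurd[OF _ ConE1[OF Assm[of "''b'' \<^bold>\<in> ''z'' \<^bold>\<and> ''b'' \<^bold>\<in> ''y''"]]]) auto
        qed
        moreover have "?K \<^bold>\<turnstile> ''y'' \<^bold>\<notin> ''x''"
          by (rule ConE1[OF Assm[of ?Y]]) simp
        ultimately have "?K \<^bold>\<turnstile> ?M"
          by (intro DisI2 ConI)
        then show ?thesis
          by (intro ExiI_self AllI) (auto simp: fv_AC_star AC_h_def Choice_def)
      qed
      show "?H \<^bold>\<turnstile> ?goal"
        by (intro ExiI_self AllI case_split[OF nonempty empty])
          (auto simp: fv_AC_star AC_h_def Choice_def)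
    qed (auto simp: fv_AC_star AC_h_def A_fm_def B_fm_def)
  qed
  have failure_case: "{\<^bold>\<not> AC_h, AC_star} \<^bold>\<turnstile> ?goal"
  proof -
    let ?G = "{\<^bold>\<not> AC_h, AC_star}"
    let ?R = "\<^bold>\<exists>''a''\<^bold>\<in>''y''. \<^bold>\<forall>''z1''\<^bold>\<in>''x''. ''y'' \<^bold>\<noteq> ''z1'' \<^bold>\<rightarrow> ''a'' \<^bold>\<notin> ''z1''"
    let ?Rz = "\<^bold>\<exists>''a''\<^bold>\<in>''z''. \<^bold>\<forall>''z1''\<^bold>\<in>''x''. ''z'' \<^bold>\<noteq> ''z1'' \<^bold>\<rightarrow> ''a'' \<^bold>\<notin> ''z1''"
    let ?Y = "''y'' \<^bold>\<in> ''x'' \<^bold>\<and> \<^bold>\<not> ?R"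
    \<comment> \<open>If no \<open>y\<close> were a counterexample, every \<open>z\<close> in
      \<open>x\<close> would satisfy \<open>?Rz\<close>, which is \<open>AC_h\<close>.\<close>
    have "?G \<^bold>\<turnstile> \<^bold>\<exists>''y''. ?Y"
    proof (rule Raa)
      let ?H = "insert (\<^bold>\<not> (\<^bold>\<exists>''y''. ?Y)) ?G"
      have "?H \<^bold>\<turnstile> AC_h"
        unfolding AC_h_def
      proof (intro AllI ImpI)
        \<comment> \<open>The negated \<open>AC_h\<close> appears here in unfolded form, because its
          definition has been unfolded in the assumptions too.\<close>
        let ?K = "insert (''z'' \<^bold>\<in> ''x'') (insert (\<^bold>\<not> (\<^bold>\<exists>''y''. ?Y)) {\<^bold>\<not> (\<^bold>\<forall>''z''\<^bold>\<in>''x''. ?Rz), AC_star})"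
        show "?K \<^bold>\<turnstile> ?Rz"
        proof (rule Raa)
          let ?L = "insert (\<^bold>\<not> ?Rz) ?K"
          have "?L \<^bold>\<turnstile> ''z'' \<^bold>\<in> ''x'' \<^bold>\<and> \<^bold>\<not> ?Rz"
            by (intro ConI Assm) auto
          then have "?L \<^bold>\<turnstile> \<^bold>\<exists>''y''. ?Y"
            by (rule ExiI_eq[where w = "''z''"]) simp_all
          then show "?L \<^bold>\<turnstile> \<^bold>\<bottom>"
            by (rule ImpE[OF Assm, rotated]) simp
        qed
      qed (auto simp: fv_AC_star)
      then show "?H \<^bold>\<turnstile> \<^bold>\<bottom>"
        by (rule ImpE[OF Assm, rotated]) simp
    qed
    then show ?thesis
    proof (rule ExiE)
      let ?H = "insert ?Y ?G"
      let ?Q = "''a'' \<^bold>\<in> ''x'' \<^bold>\<and> ''a'' \<^bold>\<noteq> ''y'' \<^bold>\<and> ''z'' \<^bold>\<in> ''a''"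
      \<comment> \<open>Cases on whether \<open>z\<close> lies in an element of \<open>x\<close>
        other than \<open>y\<close>. If so, that element is the \<open>a\<close> of
        \<open>A_fm\<close>.\<close>
      let ?S = "\<^bold>\<exists>''a''. ?Q"
      have M: "K \<^bold>\<turnstile> ?M" if "?H \<subseteq> K" and "K \<^bold>\<turnstile> A_fm" for K
        by (rule DisI1, rule ConI[OF ConE1[OF Assm[of ?Y]] that(2)]) (use that(1) in simp)
      have covered: "insert ?S ?H \<^bold>\<turnstile> \<^bold>\<exists>''a''. \<^bold>\<forall>''b''. ?M"
      proof (rule ExiE[OF Assm])
        let ?K = "insert ?Q (insert ?S ?H)"
        have "?K \<^bold>\<turnstile> A_fm"
          unfolding A_fm_def by (intro ImpI Assm) simp
        then have "?K \<^bold>\<turnstile> ?M"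
          by (rule M[rotated]) auto
        then show "?K \<^bold>\<turnstile> \<^bold>\<exists>''a''. \<^bold>\<forall>''b''. ?M"
          by (intro ExiI_self AllI) (auto simp: fv_AC_star AC_h_def)
      qed (auto simp: fv_AC_star AC_h_def)
      have uncovered: "insert (\<^bold>\<not> ?S) ?H \<^bold>\<turnstile> \<^bold>\<exists>''a''. \<^bold>\<forall>''b''. ?M"
      proof -
        let ?K = "insert (\<^bold>\<not> ?S) ?H"
        let ?L = "insert (''z'' \<^bold>\<in> ''y'') ?K"
        \<comment> \<open>Otherwise a \<open>z\<close> in \<open>y\<close> would witness
          \<open>?R\<close>, contrary to the choice of \<open>y\<close>. Hence
          \<open>z \<notin> y\<close>, and \<open>A_fm\<close> holds for any
          \<open>a\<close>.\<close>
        have "?L \<^bold>\<turnstile> \<^bold>\<forall>''z1''\<^bold>\<in>''x''. ''y'' \<^bold>\<noteq> ''z1'' \<^bold>\<rightarrow> ''z'' \<^bold>\<notin> ''z1''"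
        proof (intro AllI ImpI)
          let ?N = "insert (''z'' \<^bold>\<in> ''z1'') (insert (''y'' \<^bold>\<noteq> ''z1'') (insert (''z1'' \<^bold>\<in> ''x'') ?L))"
          have "?N \<^bold>\<turnstile> ''z1'' \<^bold>\<in> ''x'' \<^bold>\<and> ''z1'' \<^bold>\<noteq> ''y'' \<^bold>\<and> ''z'' \<^bold>\<in> ''z1''"
            by (intro ConI NotEql_sym[of _ "''y''"] Assm) auto
          then have "?N \<^bold>\<turnstile> ?S"
            by (rule ExiI_eq[where w = "''z1''"]) simp_all
          then show "?N \<^bold>\<turnstile> \<^bold>\<bottom>"
            by (rule ImpE[OF Assm, rotated]) simp
        qed (auto simp: fv_AC_star AC_h_def)
        moreover have "?L \<^bold>\<turnstile> ''z'' \<^bold>\<in> ''y''"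
          by (rule Assm) simp
        ultimately have "?L \<^bold>\<turnstile> ''z'' \<^bold>\<in> ''y'' \<^bold>\<and> (\<^bold>\<forall>''z1''\<^bold>\<in>''x''. ''y'' \<^bold>\<noteq> ''z1'' \<^bold>\<rightarrow> ''z'' \<^bold>\<notin> ''z1'')"
          by (intro ConI)
        then have "?L \<^bold>\<turnstile> ?R"
          by (rule ExiI_eq[where w = "''z''"]) simp_all
        moreover have "?L \<^bold>\<turnstile> \<^bold>\<not> ?R"
          by (rule ConE2[OF Assm[of ?Y]]) simp
        ultimately have "?L \<^bold>\<turnstile> ?Q"
          by (rule contradiction)
        then have "?K \<^bold>\<turnstile> A_fm"
          unfolding A_fm_def by (rule ImpI)
        then have "?K \<^bold>\<turnstile> ?M"
          by (rule M[rotated]) auto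
        then show ?thesis
          by (intro ExiI_self AllI) (auto simp: fv_AC_star AC_h_def)
      qed
      show "?H \<^bold>\<turnstile> ?goal"
        by (intro ExiI_self AllI case_split[OF covered uncovered])
          (auto simp: fv_AC_star AC_h_def)
    qed (auto simp: fv_AC_star AC_h_def)
  qed
  show ?thesis
    unfolding AC_star_star_def
    by (rule AllI[OF case_split[OF choice_case failure_case]]) (simp add: fv_AC_star)
qed

text \<open>The semantic half follows from the two derivations by \<open>soundness\<close>, applied
  to each assignment into \<open>D\<close> separately.\<close>

theorem theorem4p1:
  "({} \<^bold>\<turnstile> AC_star_star \<^bold>\<leftrightarrow> AC_star) \<and>
   (\<forall>(D :: 'a set) E. D \<noteq> {} \<longrightarrow> (true_in D E AC_star_star \<longleftrightarrow> true_in D E AC_star))"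
proof (intro conjI allI impI)
  show "{} \<^bold>\<turnstile> AC_star_star \<^bold>\<leftrightarrow> AC_star"
    by (intro ConI ImpI AC_star_star_imp_AC_star AC_star_imp_AC_star_star)
next
  fix D :: "'a set" and E
  have "sat D E e AC_star_star \<longleftrightarrow> sat D E e AC_star" if "range e \<subseteq> D" for e
    using soundness[OF AC_star_star_imp_AC_star that] soundness[OF AC_star_imp_AC_star_star that]
    by (metis singletonD)
  then show "true_in D E AC_star_star \<longleftrightarrow> true_in D E AC_star"
    unfolding true_in_def by blast
qed

end
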